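(* Let $H\in M_N(\mathbb C)$ be a complex Hadamard matrix and $U=H/\sqrt N$. Consider $$E_U=\{B\in M_N(\mathbb C):B=B^*,\ \Phi(U,B)=0\}$$ and $$D_U=\Big\{A\in M_N(\mathbb R):\sum_k\overline{U_{ki}}U_{kj}(A_{ki}-A_{kj})=0\ \text{for all } i,j\Big\}.$$ The map $B\mapsto\left[(UB)_{ij}\overline{U_{ij}}\right]_{ij}$ is an isomorphism of real vector spaces from $E_U$ onto $D_U$. In particular $\dim_{\mathbb R}E_U=\dim_{\mathbb R}D_U$.
   Context: A complex Hadamard matrix is an $N\times N$ matrix whose entries all have modulus $1$ and whose rows are pairwise orthogonal. For $U\in U(N)$ with all entries nonzero, let $S_{ij}=U_{ij}/|U_{ij}|$ and $X=S^*U$. For hermitian $B$ define $$\Phi(U,B)=\mathrm{Tr}(XB^2)-\sum_{i,j}\frac{\mathrm{Re}\left[(UB)_{ij}\overline{S_{ij}}\right]^2}{|U_{ij}|}.$$ *)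

theory Defs
  imports "HOL-Analysis.Analysis"
begin

text \<open>The matrices of \<open>M\<^sub>N(\<complex>)\<close> are elements of \<^typ>\<open>complex^'n^'n\<close>, with \<open>N = CARD('n)\<close>.\<close>

definition conj_transpose :: "complex^'n^'m \<Rightarrow> complex^'m^'n" where
  "conj_transpose A = (\<chi> i j. cnj (A $ j $ i))"

definition hermitian_matrix :: "complex^'n^'n \<Rightarrow> bool" where
  "hermitian_matrix B \<longleftrightarrow> B = conj_transpose B"

definition complex_hadamard :: "complex^'n^'n \<Rightarrow> bool" where
  "complex_hadamard H \<longleftrightarrow>
     (\<forall>i j. cmod (H $ i $ j) = 1) \<and>
     (\<forall>i j. i \<noteq> j \<longrightarrow> (\<Sum>k\<in>UNIV. H $ i $ k * cnj (H $ j $ k)) = 0)"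

definition phase_matrix :: "complex^'n^'n \<Rightarrow> complex^'n^'n" where
  "phase_matrix U = (\<chi> i j. U $ i $ j / complex_of_real (cmod (U $ i $ j)))"

text \<open>\<open>\<Phi>(U,B)\<close> is complex-valued, since for a general unitary \<open>U\<close> the matrix \<open>X = S\<^sup>*U\<close> need not
  be hermitian. The square in the sum is that of the real part. The formula is meant for unitary
  \<open>U\<close> without zero entries and for hermitian \<open>B\<close>.\<close>

definition Phi :: "complex^'n^'n \<Rightarrow> complex^'n^'n \<Rightarrow> complex" where
  "Phi U B =
     (let S = phase_matrix U; X = conj_transpose S ** U
      in trace (X ** (B ** B)) -
         complex_of_real
           (\<Sum>i\<in>UNIV. \<Sum>j\<in>UNIV. (Re ((U ** B) $ i $ j * cnj (S $ i $ j)))\<^sup>2 / cmod (U $ i $ j)))"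

definition E_space :: "complex^'n^'n \<Rightarrow> (complex^'n^'n) set" where
  "E_space U = {B. hermitian_matrix B \<and> Phi U B = 0}"

definition D_space :: "complex^'n^'n \<Rightarrow> (real^'n^'n) set" where
  "D_space U =
     {A. \<forall>i j. (\<Sum>k\<in>UNIV. cnj (U $ k $ i) * U $ k $ j * complex_of_real (A $ k $ i - A $ k $ j)) = 0}"

definition real_iso_between ::
    "('a::real_vector \<Rightarrow> 'b::real_vector) \<Rightarrow> 'a set \<Rightarrow> 'b set \<Rightarrow> bool" where
  "real_iso_between f V W \<longleftrightarrow>
     subspace V \<and> subspace W \<and>
     (\<forall>x\<in>V. \<forall>y\<in>V. f (x + y) = f x + f y) \<and>
     (\<forall>c. \<forall>x\<in>V. f (c *\<^sub>R x) = c *\<^sub>R f x) \<and>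
     bij_betw f V W"

end

theory Submission
  imports Defs
begin

text \<open>For real \<open>A\<close> write \<open>A\<circ>U\<close> for the entrywise product; the defining equations of \<open>D\<^sub>U\<close> say that
  \<open>U\<^sup>*(A\<circ>U)\<close> is hermitian. If \<open>U\<close> is unitary with all entries of modulus \<open>1/s\<close>, then \<open>X = s I\<close>, and
  unitarity turns \<open>Tr(B\<^sup>2)\<close> into the sum of the squared moduli of the entries of \<open>UB\<close>. Hence \<open>\<Phi>(U,B)\<close>
  is \<open>s\<^sup>3\<close> times the sum of the squared imaginary parts of the numbers \<open>(UB)\<^sub>i\<^sub>j cnj U\<^sub>i\<^sub>j\<close>. It vanishes
  iff \<open>(UB)\<^sub>i\<^sub>j cnj U\<^sub>i\<^sub>j = A\<^sub>i\<^sub>j\<close> for some real \<open>A\<close>, which is to say \<open>B = s\<^sup>2 U\<^sup>*(A\<circ>U)\<close>, and this \<open>B\<close> is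
  hermitian iff \<open>A\<close> lies in \<open>D\<^sub>U\<close>.\<close>

lemma linear_matrix_mult_left:
  fixes M :: "'a::real_algebra_1^'n^'m"
  shows "linear (\<lambda>A :: 'a^'p^'n. M ** A)"
  by (rule linearI)
    (simp_all add: vec_eq_iff matrix_matrix_mult_def distrib_left sum.distrib scaleR_sum_right)

lemma real_iso_betweenI:
  assumes "linear f" "subspace V" "bij_betw f V W"
  shows "real_iso_between f V W"
proof -
  have "subspace W"
    using assms linear_subspace_image by (auto simp: bij_betw_def)
  then show ?thesis
    using assms by (simp add: real_iso_between_def linear_add linear_scale)
qed

lemma dim_eq_if_linear_bij_betw:
  fixes f :: "'a::euclidean_space \<Rightarrow> 'b::euclidean_space"
  assumes "linear f" "subspace V" "bij_betw f V W"
  shows "dim V = dim W"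
  using assms dim_image_eq[of f V] by (simp add: bij_betw_def span_eq_iff[THEN iffD2])

lemma conj_transpose_mult:
  "conj_transpose (A ** B) = conj_transpose B ** conj_transpose A"
  by (simp add: vec_eq_iff conj_transpose_def matrix_matrix_mult_def mult.commute)

lemma linear_conj_transpose: "linear conj_transpose"
  by (rule linearI) (simp_all add: vec_eq_iff conj_transpose_def)

lemma hermitian_matrix_scaleR_iff:
  assumes "c \<noteq> 0"
  shows "hermitian_matrix (c *\<^sub>R A) \<longleftrightarrow> hermitian_matrix A"
  using assms by (simp add: hermitian_matrix_def linear_scale[OF linear_conj_transpose])

lemma subspace_hermitian_matrix: "subspace (Collect hermitian_matrix)"
  using linear_subspace_kernel[OF linear_compose_sub[OF linear_id linear_conj_transpose]]
  by (simp add: hermitian_matrix_def[abs_def])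

lemma trace_conj_transpose_mult_self:
  "trace (conj_transpose A ** A) = complex_of_real (\<Sum>i\<in>UNIV. \<Sum>j\<in>UNIV. (cmod (A $ i $ j))\<^sup>2)"
proof -
  have "trace (conj_transpose A ** A) =
      (\<Sum>j\<in>UNIV. \<Sum>i\<in>UNIV. complex_of_real ((cmod (A $ i $ j))\<^sup>2))"
    unfolding trace_def matrix_matrix_mult_def conj_transpose_def
    by (simp add: complex_norm_square mult.commute del: of_real_power)
  also have "\<dots> = (\<Sum>i\<in>UNIV. \<Sum>j\<in>UNIV. complex_of_real ((cmod (A $ i $ j))\<^sup>2))"
    by (rule sum.swap)
  finally show ?thesis by simp
qed

lemma conj_transpose_mult_self_isometry:
  assumes "conj_transpose U ** U = mat 1"
  shows "conj_transpose (U ** A) ** (U ** A) = conj_transpose A ** A"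
proof -
  have "conj_transpose (U ** A) ** (U ** A) = conj_transpose A ** (conj_transpose U ** U) ** A"
    by (simp add: conj_transpose_mult matrix_mul_assoc)
  then show ?thesis
    by (simp add: assms)
qed

definition entrywise_scaleR :: "real^'n^'m \<Rightarrow> complex^'n^'m \<Rightarrow> complex^'n^'m" where
  "entrywise_scaleR A U = (\<chi> i j. A $ i $ j *\<^sub>R U $ i $ j)"

lemma entrywise_scaleR_nth [simp]:
  "entrywise_scaleR A U $ i $ j = A $ i $ j *\<^sub>R U $ i $ j"
  by (simp add: entrywise_scaleR_def)

lemma linear_entrywise_scaleR: "linear (\<lambda>A. entrywise_scaleR A U)"
  by (rule linearI) (simp_all add: vec_eq_iff algebra_simps)

lemma linear_mult_entrywise_scaleR: "linear (\<lambda>A. M ** entrywise_scaleR A U)"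
  using linear_compose[OF linear_entrywise_scaleR linear_matrix_mult_left] by (simp add: o_def)

lemma mem_D_space_iff_hermitian:
  "A \<in> D_space U \<longleftrightarrow> hermitian_matrix (conj_transpose U ** entrywise_scaleR A U)"
proof -
  let ?M = "conj_transpose U ** entrywise_scaleR A U"
  have "conj_transpose ?M $ i $ j - ?M $ i $ j =
      (\<Sum>k\<in>UNIV. cnj (U $ k $ i) * U $ k $ j * complex_of_real (A $ k $ i - A $ k $ j))" for i j
    unfolding conj_transpose_def matrix_matrix_mult_def
    by (simp add: scaleR_conv_of_real algebra_simps flip: sum_subtractf)
  then have "A \<in> D_space U \<longleftrightarrow> (\<forall>i j. conj_transpose ?M $ i $ j - ?M $ i $ j = 0)"
    by (simp add: D_space_def)
  then show ?thesis
    by (auto simp: hermitian_matrix_def vec_eq_iff)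
qed

lemma subspace_D_space: "subspace (D_space U)"
  using linear_subspace_vimage[OF linear_mult_entrywise_scaleR[of "conj_transpose U" U]
      subspace_hermitian_matrix]
  by (simp add: vimage_def flip: mem_D_space_iff_hermitian)

definition complex_phase_coords :: "complex^'n^'m \<Rightarrow> complex^'n^'n \<Rightarrow> complex^'n^'m" where
  "complex_phase_coords U B = (\<chi> i j. (U ** B) $ i $ j * cnj (U $ i $ j))"

text \<open>Along the curve \<open>t \<mapsto> U exp(\<i>tB)\<close> the phase of the \<open>(i,j)\<close> entry has initial velocity
  \<open>phase_coords U B $ i $ j / \<bar>U\<^sub>i\<^sub>j\<bar>\<^sup>2\<close>.\<close>

definition phase_coords :: "complex^'n^'m \<Rightarrow> complex^'n^'n \<Rightarrow> real^'n^'m" where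
  "phase_coords U B = (\<chi> i j. Re (complex_phase_coords U B $ i $ j))"

lemma complex_phase_coords_nth:
  "complex_phase_coords U B $ i $ j = (U ** B) $ i $ j * cnj (U $ i $ j)"
  by (simp add: complex_phase_coords_def)

lemma phase_coords_nth [simp]: "phase_coords U B $ i $ j = Re (complex_phase_coords U B $ i $ j)"
  by (simp add: phase_coords_def)

lemma linear_phase_coords: "linear (phase_coords U)"
  by (rule linearI)
    (simp_all add: vec_eq_iff complex_phase_coords_nth algebra_simps
      linear_add[OF linear_matrix_mult_left] linear_scale[OF linear_matrix_mult_left])

locale flat_unitary =
  fixes U :: "complex^'n^'n" and s :: real
  assumes scale_pos: "s > 0"
    and cmod_entry: "cmod (U $ i $ j) = 1 / s"
    and unitary: "conj_transpose U ** U = mat 1"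
begin

lemma mult_conj_transpose: "U ** conj_transpose U = mat 1"
  using unitary by (simp add: matrix_left_right_inverse)

lemma entry_mult_cnj: "U $ i $ j * cnj (U $ i $ j) = complex_of_real (1 / s\<^sup>2)"
  by (simp add: cmod_entry power_divide flip: complex_norm_square)

lemma phase_matrix_eq: "phase_matrix U = s *\<^sub>R U"
  using scale_pos by (simp add: vec_eq_iff phase_matrix_def cmod_entry
      scaleR_conv_of_real[where 'a = complex])

lemma trace_phase_matrix_mult:
  assumes "hermitian_matrix B"
  shows "trace (conj_transpose (phase_matrix U) ** U ** (B ** B)) =
    complex_of_real (s * (\<Sum>i\<in>UNIV. \<Sum>j\<in>UNIV. (cmod ((U ** B) $ i $ j))\<^sup>2))"
proof -
  have "B ** B = conj_transpose (U ** B) ** (U ** B)"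
    using assms conj_transpose_mult_self_isometry[OF unitary, of B]
    by (simp add: hermitian_matrix_def)
  moreover have "conj_transpose (phase_matrix U) ** U ** (B ** B) = s *\<^sub>R (B ** B)"
    by (simp add: phase_matrix_eq linear_scale[OF linear_conj_transpose] unitary
        flip: scalar_matrix_assoc)
  moreover have "trace (s *\<^sub>R M) = complex_of_real s * trace M" for M :: "complex^'n^'n"
    by (simp add: trace_def sum_distrib_left scaleR_conv_of_real[where 'a = complex])
  ultimately show ?thesis
    by (simp add: trace_conj_transpose_mult_self)
qed

lemma Phi_eq_sum_Im_squares:
  assumes "hermitian_matrix B"
  shows "Phi U B = complex_of_real
    (s ^ 3 * (\<Sum>i\<in>UNIV. \<Sum>j\<in>UNIV. (Im (complex_phase_coords U B $ i $ j))\<^sup>2))"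
proof -
  let ?W = "complex_phase_coords U B"
  have cmod_sq: "s * (cmod ((U ** B) $ i $ j))\<^sup>2 = s ^ 3 * (cmod (?W $ i $ j))\<^sup>2" for i j
    using scale_pos
    by (simp add: complex_phase_coords_nth norm_mult cmod_entry field_simps eval_nat_numeral)
  have "(U ** B) $ i $ j * cnj (phase_matrix U $ i $ j) = s *\<^sub>R ?W $ i $ j" for i j
    by (simp add: phase_matrix_eq complex_phase_coords_nth)
  then have Re_sq: "(Re ((U ** B) $ i $ j * cnj (phase_matrix U $ i $ j)))\<^sup>2 / cmod (U $ i $ j) =
      s ^ 3 * (Re (?W $ i $ j))\<^sup>2" for i j
    by (simp add: cmod_entry power_mult_distrib eval_nat_numeral del: times_complex.sel)
  have "Phi U B = complex_of_real ((\<Sum>i\<in>UNIV. \<Sum>j\<in>UNIV. s ^ 3 * (cmod (?W $ i $ j))\<^sup>2) -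
      (\<Sum>i\<in>UNIV. \<Sum>j\<in>UNIV. s ^ 3 * (Re (?W $ i $ j))\<^sup>2))"
    unfolding Phi_def Let_def trace_phase_matrix_mult[OF assms] sum_distrib_left cmod_sq Re_sq
      of_real_diff ..
  then show ?thesis
    by (simp add: cmod_power2 distrib_left sum.distrib sum_distrib_left)
qed

lemma mem_E_space_iff:
  "B \<in> E_space U \<longleftrightarrow> hermitian_matrix B \<and> (\<forall>i j. complex_phase_coords U B $ i $ j \<in> \<real>)"
  using scale_pos
  by (auto simp: E_space_def Phi_eq_sum_Im_squares sum_nonneg_eq_0_iff sum_nonneg
      complex_is_Real_iff simp del: of_real_mult of_real_sum)

lemma of_real_phase_coords:
  assumes "B \<in> E_space U"
  shows "complex_of_real (phase_coords U B $ i $ j) = (U ** B) $ i $ j * cnj (U $ i $ j)"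
  using assms by (simp add: mem_E_space_iff flip: complex_phase_coords_nth)

definition from_phase_coords :: "real^'n^'n \<Rightarrow> complex^'n^'n" where
  "from_phase_coords A = s\<^sup>2 *\<^sub>R (conj_transpose U ** entrywise_scaleR A U)"

lemma linear_from_phase_coords: "linear from_phase_coords"
  unfolding from_phase_coords_def
  by (intro linear_compose_scale_right linear_mult_entrywise_scaleR)

lemma mult_from_phase_coords: "U ** from_phase_coords A = s\<^sup>2 *\<^sub>R entrywise_scaleR A U"
  by (simp add: from_phase_coords_def linear_scale[OF linear_matrix_mult_left] matrix_mul_assoc
      mult_conj_transpose)

lemma complex_phase_coords_from_phase_coords:
  "complex_phase_coords U (from_phase_coords A) $ i $ j = complex_of_real (A $ i $ j)"
  using scale_pos
  by (simp add: complex_phase_coords_nth mult_from_phase_coords entry_mult_cnj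
      scaleR_conv_of_real[where 'a = complex])

lemma phase_coords_from_phase_coords: "phase_coords U (from_phase_coords A) = A"
  by (simp add: vec_eq_iff complex_phase_coords_from_phase_coords)

lemma from_phase_coords_phase_coords:
  assumes "B \<in> E_space U"
  shows "from_phase_coords (phase_coords U B) = B"
proof -
  have "s\<^sup>2 *\<^sub>R entrywise_scaleR (phase_coords U B) U = U ** B"
  proof -
    have "complex_of_real (phase_coords U B $ i $ j) * U $ i $ j =
        (U ** B) $ i $ j * (U $ i $ j * cnj (U $ i $ j))" for i j
      by (simp only: of_real_phase_coords[OF assms] mult_ac)
    then show ?thesis
      using scale_pos
      by (simp add: vec_eq_iff entry_mult_cnj scaleR_conv_of_real[where 'a = complex]
          del: phase_coords_nth)
  qed
  then have "from_phase_coords (phase_coords U B) = conj_transpose U ** (U ** B)"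
    by (simp add: from_phase_coords_def flip: linear_scale[OF linear_matrix_mult_left])
  also have "\<dots> = B"
    by (simp add: matrix_mul_assoc unitary)
  finally show ?thesis .
qed

lemma from_phase_coords_mem_E_space_iff: "from_phase_coords A \<in> E_space U \<longleftrightarrow> A \<in> D_space U"
proof -
  have "hermitian_matrix (from_phase_coords A) \<longleftrightarrow> A \<in> D_space U"
    using scale_pos
    by (simp add: from_phase_coords_def hermitian_matrix_scaleR_iff mem_D_space_iff_hermitian)
  then show ?thesis
    by (simp add: mem_E_space_iff complex_phase_coords_from_phase_coords)
qed

lemma bij_betw_phase_coords: "bij_betw (phase_coords U) (E_space U) (D_space U)"
proof (rule bij_betw_byWitness[where f' = from_phase_coords])
  show "phase_coords U ` E_space U \<subseteq> D_space U"
    by (auto simp: from_phase_coords_phase_coords simp flip: from_phase_coords_mem_E_space_iff)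
qed (auto simp: from_phase_coords_phase_coords phase_coords_from_phase_coords
    from_phase_coords_mem_E_space_iff)

lemma subspace_E_space: "subspace (E_space U)"
proof -
  have "from_phase_coords ` phase_coords U ` E_space U = E_space U"
    by (simp add: image_image from_phase_coords_phase_coords)
  then have "from_phase_coords ` D_space U = E_space U"
    by (simp add: bij_betw_imp_surj_on[OF bij_betw_phase_coords])
  then show ?thesis
    using linear_subspace_image[OF linear_from_phase_coords subspace_D_space[of U]] by simp
qed

end

lemma complex_hadamard_mult_conj_transpose:
  fixes H :: "complex^'n^'n"
  assumes "complex_hadamard H"
  shows "H ** conj_transpose H = real CARD('n) *\<^sub>R mat 1"
proof -
  have "H $ i $ k * cnj (H $ i $ k) = 1" for i k
    using assms complex_norm_square[of "H $ i $ k"] by (simp add: complex_hadamard_def)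
  then show ?thesis
    using assms
    by (simp add: complex_hadamard_def vec_eq_iff matrix_matrix_mult_def conj_transpose_def mat_def
        scaleR_conv_of_real[where 'a = complex])
qed

lemma flat_unitary_normalized_hadamard:
  fixes H :: "complex^'n^'n"
  assumes "complex_hadamard H"
  shows "flat_unitary ((1 / sqrt (real CARD('n))) *\<^sub>R H) (sqrt (real CARD('n)))"
proof
  let ?U = "(1 / sqrt (real CARD('n))) *\<^sub>R H"
  have "?U ** conj_transpose ?U = (1 / real CARD('n)) *\<^sub>R (H ** conj_transpose H)"
    by (simp add: linear_scale[OF linear_conj_transpose] matrix_scalar_ac flip: scalar_matrix_assoc)
  then have "?U ** conj_transpose ?U = mat 1"
    by (simp add: complex_hadamard_mult_conj_transpose[OF assms])
  then show "conj_transpose ?U ** ?U = mat 1"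
    by (simp add: matrix_left_right_inverse)
qed (use assms in \<open>simp_all add: complex_hadamard_def\<close>)

theorem theorem8p3:
  fixes H U :: "complex^'n^'n"
  assumes "complex_hadamard H"
    and "U = (1 / sqrt (real CARD('n))) *\<^sub>R H"
  shows "(\<exists>f :: complex^'n^'n \<Rightarrow> real^'n^'n.
            (\<forall>B\<in>E_space U. \<forall>i j.
               complex_of_real (f B $ i $ j) = (U ** B) $ i $ j * cnj (U $ i $ j)) \<and>
            real_iso_between f (E_space U) (D_space U)) \<and>
         dim (E_space U) = dim (D_space U)"
proof -
  interpret flat_unitary U "sqrt (real CARD('n))"
    using flat_unitary_normalized_hadamard[OF assms(1)] assms(2) by simp
  note linear_bij = linear_phase_coords subspace_E_space bij_betw_phase_coords
  have "\<forall>B\<in>E_space U. \<forall>i j.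
      complex_of_real (phase_coords U B $ i $ j) = (U ** B) $ i $ j * cnj (U $ i $ j)"
    using of_real_phase_coords by blast
  moreover have "real_iso_between (phase_coords U) (E_space U) (D_space U)"
    using linear_bij by (rule real_iso_betweenI)
  moreover have "dim (E_space U) = dim (D_space U)"
    using linear_bij by (rule dim_eq_if_linear_bij_betw)
  ultimately show ?thesis
    by blast
qed

end
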